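(* Let $n\ge2$ and let $\mathcal{L}_n$ be the graph whose vertices are the planar layouts of irreducible planar tanglegrams of size $n$, two layouts being adjacent if one is obtained from the other by a rotation (as defined in the context). Then $\mathcal{L}_n$ is isomorphic to the flip graph $\mathcal{D}_{n+1}$ on ordered pairs of disjoint triangulations of a convex $(n+1)$-gon.
   Context: Tanglegrams: a tanglegram $(L,R,\sigma)$ is an ordered pair of rooted binary trees (each vertex has $0$ or $2$ children) with the same number $n$ of leaves (the size) and a perfect matching $\sigma$ between their leaves. A planar layout draws $L$ left of $x=0$ with leaves on $x=0$, $R$ right of $x=1$ with leaves on $x=1$, and matching edges as noncrossing straight segments; it is determined by the pair $(P_1,P_2)$ of plane binary trees (trees with left/right order of children) obtained, where the $i$-th leaf from the top of $P_1$ is matched with the $i$-th leaf from the top of $P_2$. A proper subtanglegram of such a pair is a pair of internal non-root vertices $u\in P_1$, $v\in P_2$ whose leaf descendants are matched exactly to each other; the tanglegram is irreducible if there is none. Rotation in a plane binary tree: let $v$ be an internal non-root vertex with parent $u$. If $v$ is the left child of $u$, with $v$ having children subtrees $A$ (left), $B$ (right) and $u$ having right subtree $C$, the rotation at $v$ puts $v$ in the place of $u$, with left subtree $A$ and right child $u$, where $u$ now has left subtree $B$ and right subtree $C$; the case where $v$ is a right child is the mirror image. Rotation of a planar layout $(P_1,P_2)$ of an irreducible planar tanglegram at an internal non-root vertex $w\in V(P_i)$: (a) rotate at $w$ in $P_i$, obtaining $P_i'$; (b) if the resulting pair (with $P_i'$ in place of $P_i$) contains a proper subtanglegram, rooted at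 $w_1\in V(P_i')$ and $w_2\in V(P_j)$ with $j\ne i$, then additionally rotate at $w_2$ in $P_j$. Triangulations: a triangulation of a convex polygon is a maximal set of noncrossing diagonals; two are disjoint if they share no diagonal. Flipping a diagonal $(a,b)$ of a triangulation replaces it by the other diagonal $(a',b')$ of the quadrilateral $(a,a',b,b')$ formed on deleting it. For an ordered pair $(T_1,T_2)$ of disjoint triangulations and $(a,b)\in T_i$, the flip at $(a,b)_i$ flips $(a,b)$ in $T_i$ and, if the new diagonal lies in $T_j$ ($j\neq i$), also flips it in $T_j$. $\mathcal{D}_{m}$ is the graph on ordered pairs of disjoint triangulations of the $m$-gon with adjacency given by such flips. *)

theory Defs
  imports "Graph_Theory.Graph_Theory"
begin

section \<open>Plane binary trees\<close>

datatype plane_tree = Leaf | Node plane_tree plane_tree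

text \<open>A vertex is addressed by the path leading to it from the root, which is \<open>[]\<close>.\<close>

datatype side = Left | Right

type_synonym vertex = "side list"

fun num_leaves :: "plane_tree \<Rightarrow> nat" where
  "num_leaves Leaf = 1"
| "num_leaves (Node l r) = num_leaves l + num_leaves r"

fun internal_vertices :: "plane_tree \<Rightarrow> vertex set" where
  "internal_vertices Leaf = {}"
| "internal_vertices (Node l r) =
     insert [] ((#) Left ` internal_vertices l \<union> (#) Right ` internal_vertices r)"

text \<open>The leaf descendants of a vertex, each leaf being given by its position in the plane order,
  counted from \<open>0\<close>; the set is empty for a path that leaves the tree.\<close>

fun leaf_descendants :: "plane_tree \<Rightarrow> vertex \<Rightarrow> nat set" where
  "leaf_descendants t [] = {..<num_leaves t}"
| "leaf_descendants (Node l r) (Left # p) = leaf_descendants l p"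
| "leaf_descendants (Node l r) (Right # p) = (\<lambda>i. num_leaves l + i) ` leaf_descendants r p"
| "leaf_descendants Leaf (s # p) = {}"

text \<open>Rotation at an internal non-root vertex. On other paths the value is irrelevant (the tree is
  left unchanged).\<close>

fun rotate_at :: "vertex \<Rightarrow> plane_tree \<Rightarrow> plane_tree" where
  "rotate_at [Left] (Node (Node a b) c) = Node a (Node b c)"
| "rotate_at [Right] (Node c (Node a b)) = Node (Node c a) b"
| "rotate_at (Left # s # p) (Node l r) = Node (rotate_at (s # p) l) r"
| "rotate_at (Right # s # p) (Node l r) = Node l (rotate_at (s # p) r)"
| "rotate_at _ t = t"


section \<open>Layouts of tanglegrams and their rotations\<close>

text \<open>A planar layout is given by the plane trees \<open>(P\<^sub>1, P\<^sub>2)\<close>; children are listed from top to bottom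
  in both trees. The \<open>i\<close>-th leaf of \<open>P\<^sub>1\<close> is matched with the \<open>i\<close>-th leaf of \<open>P\<^sub>2\<close>, so in terms of
  leaf positions the matching is the identity. Every pair of trees of the same size is the layout of
  a planar tanglegram.\<close>

type_synonym layout = "plane_tree \<times> plane_tree"

definition proper_subtanglegram :: "layout \<Rightarrow> vertex \<Rightarrow> vertex \<Rightarrow> bool" where
  "proper_subtanglegram P u v \<longleftrightarrow>
     u \<in> internal_vertices (fst P) \<and> u \<noteq> [] \<and>
     v \<in> internal_vertices (snd P) \<and> v \<noteq> [] \<and>
     leaf_descendants (fst P) u = leaf_descendants (snd P) v"

definition irreducible_layout :: "layout \<Rightarrow> bool" where
  "irreducible_layout P \<longleftrightarrow> (\<nexists>u v. proper_subtanglegram P u v)"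

definition irreducible_layouts :: "nat \<Rightarrow> layout set" where
  "irreducible_layouts n =
     {(P1, P2). num_leaves P1 = n \<and> num_leaves P2 = n \<and> irreducible_layout (P1, P2)}"

inductive layout_rotation :: "layout \<Rightarrow> layout \<Rightarrow> bool" where
  fst_single: "layout_rotation (P1, P2) (rotate_at w P1, P2)"
    if "w \<in> internal_vertices P1" "w \<noteq> []" "irreducible_layout (rotate_at w P1, P2)"
| fst_double: "layout_rotation (P1, P2) (rotate_at w P1, rotate_at w2 P2)"
    if "w \<in> internal_vertices P1" "w \<noteq> []" "proper_subtanglegram (rotate_at w P1, P2) w1 w2"
| snd_single: "layout_rotation (P1, P2) (P1, rotate_at w P2)"
    if "w \<in> internal_vertices P2" "w \<noteq> []" "irreducible_layout (P1, rotate_at w P2)"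
| snd_double: "layout_rotation (P1, P2) (rotate_at w1 P1, rotate_at w P2)"
    if "w \<in> internal_vertices P2" "w \<noteq> []" "proper_subtanglegram (P1, rotate_at w P2) w1 w2"

text \<open>Undirected graphs are represented as symmetric digraphs.\<close>

definition layout_graph :: "nat \<Rightarrow> layout pair_pre_digraph" where
  "layout_graph n =
     \<lparr> pverts = irreducible_layouts n,
       parcs = {(P, Q). P \<in> irreducible_layouts n \<and> Q \<in> irreducible_layouts n \<and>
                        (layout_rotation P Q \<or> layout_rotation Q P)} \<rparr>"


section \<open>Triangulations of a convex polygon and their flips\<close>

text \<open>The vertices of the convex \<open>m\<close>-gon are \<open>0, \<dots>, m - 1\<close> in cyclic order, and a segment between two
  of them is the set of its endpoints. Two segments cross (in their interiors) iff their endpoints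
  are distinct and alternate in the cyclic order.\<close>

type_synonym segment = "nat set"

definition sides :: "nat \<Rightarrow> segment set" where
  "sides m = {{i, Suc i mod m} | i. i < m}"

definition diagonals :: "nat \<Rightarrow> segment set" where
  "diagonals m = {{a, b} | a b. a < m \<and> b < m \<and> a \<noteq> b} - sides m"

definition crosses :: "segment \<Rightarrow> segment \<Rightarrow> bool" where
  "crosses e f \<longleftrightarrow>
     (\<exists>a b c d. a < c \<and> c < b \<and> b < d \<and>
        (e = {a, b} \<and> f = {c, d} \<or> e = {c, d} \<and> f = {a, b}))"

definition noncrossing :: "segment set \<Rightarrow> bool" where
  "noncrossing T \<longleftrightarrow> (\<forall>e\<in>T. \<forall>f\<in>T. \<not> crosses e f)"

definition triangulation :: "nat \<Rightarrow> segment set \<Rightarrow> bool" where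
  "triangulation m T \<longleftrightarrow>
     T \<subseteq> diagonals m \<and> noncrossing T \<and>
     (\<forall>T'. T' \<subseteq> diagonals m \<and> noncrossing T' \<and> T \<subseteq> T' \<longrightarrow> T' = T)"

text \<open>\<open>other_diagonal m T e e'\<close>: deleting \<open>e = {a, b}\<close> from \<open>T\<close> leaves a quadrilateral
  \<open>(a, a', b, b')\<close>, whose other diagonal is \<open>e' = {a', b'}\<close>.\<close>

definition other_diagonal :: "nat \<Rightarrow> segment set \<Rightarrow> segment \<Rightarrow> segment \<Rightarrow> bool" where
  "other_diagonal m T e e' \<longleftrightarrow>
     e \<in> T \<and>
     (\<exists>a a' b b'. e = {a, b} \<and> e' = {a', b'} \<and> crosses e e' \<and>
        {{a, a'}, {a', b}, {b, b'}, {b', a}} \<subseteq> (T - {e}) \<union> sides m)"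

definition exchange :: "segment \<Rightarrow> segment \<Rightarrow> segment set \<Rightarrow> segment set" where
  "exchange e e' T = insert e' (T - {e})"

type_synonym triangulation_pair = "segment set \<times> segment set"

definition disjoint_triangulations :: "nat \<Rightarrow> triangulation_pair set" where
  "disjoint_triangulations m =
     {(T1, T2). triangulation m T1 \<and> triangulation m T2 \<and> T1 \<inter> T2 = {}}"

inductive pair_flip :: "nat \<Rightarrow> triangulation_pair \<Rightarrow> triangulation_pair \<Rightarrow> bool" for m where
  fst_single: "pair_flip m (T1, T2) (exchange e e' T1, T2)"
    if "other_diagonal m T1 e e'" "e' \<notin> T2"
| fst_double: "pair_flip m (T1, T2) (exchange e e' T1, exchange e' e'' T2)"
    if "other_diagonal m T1 e e'" "e' \<in> T2" "other_diagonal m T2 e' e''"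
| snd_single: "pair_flip m (T1, T2) (T1, exchange e e' T2)"
    if "other_diagonal m T2 e e'" "e' \<notin> T1"
| snd_double: "pair_flip m (T1, T2) (exchange e' e'' T1, exchange e e' T2)"
    if "other_diagonal m T2 e e'" "e' \<in> T1" "other_diagonal m T1 e' e''"

definition flip_graph :: "nat \<Rightarrow> triangulation_pair pair_pre_digraph" where
  "flip_graph m =
     \<lparr> pverts = disjoint_triangulations m,
       parcs = {(S, T). S \<in> disjoint_triangulations m \<and> T \<in> disjoint_triangulations m \<and>
                        (pair_flip m S T \<or> pair_flip m T S)} \<rparr>"

end

theory Submission
  imports Defs
begin

text \<open>The leaves of a plane tree lying below an internal vertex are those at the positions
  \<open>a, \<dots>, b - 1\<close> for some \<open>a < b\<close>; the vertex corresponds to the chord \<open>{a, b}\<close> of the polygon with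
  vertices \<open>0, \<dots>, n\<close>. The root gives the side \<open>{0, n}\<close>, and the other internal vertices give the
  diagonals of a triangulation. A proper subtanglegram is a diagonal shared by the two
  triangulations, and a rotation is a flip, so after a rotation the only diagonal that can be shared
  is the new one.\<close>

section \<open>The leaf intervals of the internal vertices\<close>

text \<open>Rotation is a function on trees, while a flip is a relation that only asserts that some
  quadrilateral exists. The passage from rotations to flips is therefore a computation, and the
  converse is reduced to it: a flipped diagonal belongs to some vertex, the rotation at that vertex
  flips the same diagonal, and both results agree because a diagonal of a triangulation has only one
  flip partner.

  That every triangulation comes from a tree needs no exact reconstruction either: a noncrossing
  family is merely extended to the intervals of a tree, and maximality of the triangulation turns
  the inclusion into an equality.

  Root intervals are kept throughout the inductions, since the root of a subtree is a diagonal in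
  the larger tree. Only the root of the whole tree is a side, so it is removed on passing to chords
  and put back whenever maximality or injectivity for intervals is used.\<close>

text \<open>\<open>k\<close> is the number of leaves to the left of the tree; the value is irrelevant for paths that
  leave the tree.\<close>

fun interval :: "nat \<Rightarrow> plane_tree \<Rightarrow> vertex \<Rightarrow> nat \<times> nat" where
  "interval k t [] = (k, k + num_leaves t)"
| "interval k (Node l r) (Left # p) = interval k l p"
| "interval k (Node l r) (Right # p) = interval (k + num_leaves l) r p"
| "interval k Leaf (s # p) = (k, k)"

definition intervals :: "nat \<Rightarrow> plane_tree \<Rightarrow> (nat \<times> nat) set" where
  "intervals k t = interval k t ` internal_vertices t"

lemma intervals_simps [simp]:
  "intervals k Leaf = {}"
  "intervals k (Node l r) = insert (k, k + num_leaves l + num_leaves r)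
     (intervals k l \<union> intervals (k + num_leaves l) r)"
  by (auto simp: intervals_def image_Un image_image)

lemma num_leaves_pos [simp]: "0 < num_leaves t"
  by (induction t) auto

lemma num_leaves_nonzero [simp]: "num_leaves t \<noteq> 0"
  using num_leaves_pos[of t] by linarith

lemma root_in_intervals:
  assumes "2 \<le> num_leaves t"
  shows "(k, k + num_leaves t) \<in> intervals k t"
  using assms by (cases t) auto

text \<open>The gap of 2 expresses that an internal vertex has at least two leaves below it; this is
  what keeps single leaves, the sides of the polygon, out of the family.\<close>

lemma intervals_bounds:
  assumes "(a, b) \<in> intervals k t"
  shows "k \<le> a" "a + 2 \<le> b" "b \<le> k + num_leaves t"
proof -
  have "k \<le> a \<and> a + 2 \<le> b \<and> b \<le> k + num_leaves t"
    using assms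
  proof (induction t arbitrary: k)
    case (Node l r)
    from Node.prems consider "a = k" "b = k + num_leaves l + num_leaves r"
      | "(a, b) \<in> intervals k l" | "(a, b) \<in> intervals (k + num_leaves l) r" by auto
    then show ?case
    proof cases
      case 1
      then show ?thesis using num_leaves_pos[of l] num_leaves_pos[of r]
        unfolding num_leaves.simps by linarith
    next
      case 2
      then show ?thesis using Node.IH(1)[of k] by simp
    next
      case 3
      then show ?thesis using Node.IH(2)[of "k + num_leaves l"] by simp
    qed
  qed simp
  then show "k \<le> a" "a + 2 \<le> b" "b \<le> k + num_leaves t" by auto
qed

text \<open>Feeds the bounds on intervals into statements about vertices.\<close>

lemma interval_in_intervals:
  "p \<in> internal_vertices t \<Longrightarrow> interval k t p \<in> intervals k t"
  by (simp add: intervals_def)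

text \<open>A vertex below the left child misses the last leaf, and one below the right child misses
  the first, because the sibling subtree is never empty.\<close>

lemma interval_eq_root_iff:
  assumes "p \<in> internal_vertices t"
  shows "interval k t p = (k, k + num_leaves t) \<longleftrightarrow> p = []"
proof (cases t)
  case (Node l r)
  have "interval k t p \<noteq> (k, k + num_leaves t)" if nonroot: "p \<noteq> []"
  proof -
    consider q where "p = Left # q" "q \<in> internal_vertices l"
      | q where "p = Right # q" "q \<in> internal_vertices r"
      using assms nonroot Node by auto
    then show ?thesis
    proof cases
      case 1
      then show ?thesis
        using intervals_bounds(3)[of _ _ k l] interval_in_intervals[of q l k] Node
          num_leaves_pos[of r] by fastforce
    next
      case 2
      then show ?thesis
        using intervals_bounds(1)[of _ _ "k + num_leaves l" r]
          interval_in_intervals[of q r "k + num_leaves l"] Node num_leaves_pos[of l] by fastforce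
    qed
  qed
  then show ?thesis by auto
qed (use assms in simp)

lemma image_interval_nonroot:
  "interval k t ` (internal_vertices t - {[]}) = intervals k t - {(k, k + num_leaves t)}"
  by (auto simp: intervals_def interval_eq_root_iff
      dest: interval_eq_root_iff[THEN iffD1, OF _ sym])

text \<open>The offset \<open>k\<close> is general because leaf positions in a right subtree are
  shifted by the size of its left sibling.\<close>

lemma leaf_descendants_eq_interval:
  assumes "p \<in> internal_vertices t"
  shows "(+) k ` leaf_descendants t p = {fst (interval k t p)..<snd (interval k t p)}"
  using assms
proof (induction t arbitrary: k p)
  case (Node l r)
  show ?case
  proof (cases p)
    case Nil
    then show ?thesis by (simp add: lessThan_atLeast0 add_ac)
  next
    case (Cons s q)
    show ?thesis
    proof (cases s)
      case Left
      then show ?thesis using Node Cons by auto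
    next
      case Right
      then have "q \<in> internal_vertices r" using Node Cons by auto
      moreover have "(+) k ` leaf_descendants (Node l r) p =
          (+) (k + num_leaves l) ` leaf_descendants r q"
        by (simp add: Cons Right image_image add.assoc)
      ultimately show ?thesis using Node.IH(2) by (simp add: Cons Right)
    qed
  qed
qed simp

lemma leaf_descendants_eq_iff:
  assumes "p \<in> internal_vertices t" "q \<in> internal_vertices u"
  shows "leaf_descendants t p = leaf_descendants u q \<longleftrightarrow> interval 0 t p = interval 0 u q"
proof -
  \<comment> \<open>Half-open intervals determine their endpoints only when they are
    nonempty.\<close>
  have "fst (interval 0 t p) < snd (interval 0 t p)" "fst (interval 0 u q) < snd (interval 0 u q)"
    using intervals_bounds(2)[of _ _ 0 t] intervals_bounds(2)[of _ _ 0 u]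
      interval_in_intervals assms by (metis add_lessD1 less_add_same_cancel1 order_less_le_trans
        prod.collapse zero_less_numeral)+
  then show ?thesis
    using leaf_descendants_eq_interval[OF assms(1), of 0]
      leaf_descendants_eq_interval[OF assms(2), of 0]
    by (simp add: prod_eq_iff atLeastLessThan_eq_iff)
qed

section \<open>Noncrossing families of intervals\<close>

text \<open>One of the two alternating orders suffices because all ordered pairs of members are
  considered. Common endpoints are allowed, as for diagonals meeting at a vertex of the
  polygon.\<close>

definition noncrossing_intervals :: "(nat \<times> nat) set \<Rightarrow> bool" where
  "noncrossing_intervals F \<longleftrightarrow>
     (\<forall>a b c d. (a, b) \<in> F \<longrightarrow> (c, d) \<in> F \<longrightarrow> \<not> (a < c \<and> c < b \<and> b < d))"

lemma noncrossing_intervalsD: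
  "noncrossing_intervals F \<Longrightarrow> (a, b) \<in> F \<Longrightarrow> (c, d) \<in> F \<Longrightarrow> a < c \<Longrightarrow> c < b \<Longrightarrow> b < d \<Longrightarrow> False"
  unfolding noncrossing_intervals_def by blast

lemma noncrossing_intervals_tree: "noncrossing_intervals (intervals k t)"
proof (induction t arbitrary: k)
  case (Node l r)
  show ?case unfolding noncrossing_intervals_def
  proof (intro allI impI notI)
    fix a b c d
    let ?m = "k + num_leaves l"
    assume ab: "(a, b) \<in> intervals k (Node l r)" and cd: "(c, d) \<in> intervals k (Node l r)"
      and cross: "a < c \<and> c < b \<and> b < d"
    \<comment> \<open>Neither interval can be the root's: nothing ends after the root interval or
      starts before it. Intervals from different subtrees are separated by
      \<open>?m\<close>.\<close>
    have "(a, b) \<in> intervals k l \<or> (a, b) \<in> intervals ?m r"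
      using ab intervals_bounds(3)[OF cd] cross by auto
    moreover have "(c, d) \<in> intervals k l \<or> (c, d) \<in> intervals ?m r"
      using cd intervals_bounds(1)[OF ab] cross by auto
    ultimately consider "(a, b) \<in> intervals k l" "(c, d) \<in> intervals k l"
      | "(a, b) \<in> intervals ?m r" "(c, d) \<in> intervals ?m r"
      | "b \<le> ?m" "?m \<le> c" | "?m \<le> a" "d \<le> ?m"
      using intervals_bounds(1)[of _ _ ?m r] intervals_bounds(3)[of _ _ k l] by blast
    then show False
      using noncrossing_intervalsD[OF Node.IH(1), of a b k c d]
        noncrossing_intervalsD[OF Node.IH(2), of a b ?m c d] cross by cases auto
  qed
qed (simp add: noncrossing_intervals_def)

text \<open>By induction a new interval fits into neither subtree, so it straddles the split point.
  If it did not start at \<open>k\<close> it would cross the root of the left subtree, and likewise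
  on the right; hence it would be the root interval, which is already present.\<close>

lemma intervals_maximal:
  assumes "k \<le> a" "a + 2 \<le> b" "b \<le> k + num_leaves t"
    and "noncrossing_intervals (insert (a, b) (intervals k t))"
  shows "(a, b) \<in> intervals k t"
  using assms
proof (induction t arbitrary: k)
  case (Node l r)
  let ?m = "k + num_leaves l"
  note nc = noncrossing_intervalsD[OF Node.prems(4)]
  show ?case
  proof (rule ccontr)
    assume not: "\<not> ?thesis"
    have "noncrossing_intervals (insert (a, b) (intervals k l))"
      "noncrossing_intervals (insert (a, b) (intervals ?m r))"
      using Node.prems(4) unfolding noncrossing_intervals_def by auto
    then have m: "a < ?m" "?m < b"
      using Node.IH(1)[of k] Node.IH(2)[of ?m] Node.prems not by (fastforce simp: not_less)+
    have "a = k"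
    proof (rule ccontr)
      assume "a \<noteq> k"
      then have "(k, ?m) \<in> intervals k l" using Node.prems(1) m by (intro root_in_intervals) auto
      then show False using nc[of k ?m a b] \<open>a \<noteq> k\<close> Node.prems(1) m by auto
    qed
    moreover have "b = ?m + num_leaves r"
    proof (rule ccontr)
      assume "b \<noteq> ?m + num_leaves r"
      then have "(?m, ?m + num_leaves r) \<in> intervals ?m r"
        using Node.prems(3) m by (intro root_in_intervals) auto
      then show False
        using nc[of a b ?m "?m + num_leaves r"] \<open>b \<noteq> ?m + num_leaves r\<close> Node.prems(3) m by auto
    qed
    ultimately show False using not by simp
  qed
qed simp

section \<open>Recovering a tree from its intervals\<close>

lemma intervals_left:
  "intervals k l = {(a, b) \<in> intervals k (Node l r). b \<le> k + num_leaves l}"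
proof -
  have "(a, b) \<in> intervals k l \<longleftrightarrow> (a, b) \<in> intervals k (Node l r) \<and> b \<le> k + num_leaves l"
    for a b
    using intervals_bounds(3)[of a b k l] intervals_bounds(1,2)[of a b "k + num_leaves l" r]
      num_leaves_pos[of r] by auto
  then show ?thesis by auto
qed

lemma intervals_right:
  "intervals (k + num_leaves l) r = {(a, b) \<in> intervals k (Node l r). k + num_leaves l \<le> a}"
proof -
  have "(a, b) \<in> intervals (k + num_leaves l) r \<longleftrightarrow>
      (a, b) \<in> intervals k (Node l r) \<and> k + num_leaves l \<le> a" for a b
    using intervals_bounds(2,3)[of a b k l] intervals_bounds(1)[of a b "k + num_leaves l" r]
      num_leaves_pos[of l] by auto
  then show ?thesis by auto
qed

text \<open>If \<open>l'\<close> were larger than \<open>l\<close>, its root interval would have no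
  place in the other tree: it is too short for the root, too long for \<open>l\<close>, and starts
  too early for \<open>r\<close>. Applied both ways, this shows that the intervals determine the
  split at the root.\<close>

lemma num_leaves_left_le:
  assumes "num_leaves (Node l r) = num_leaves (Node l' r')"
    and "intervals k (Node l' r') \<subseteq> intervals k (Node l r)"
  shows "num_leaves l' \<le> num_leaves l"
proof (rule ccontr)
  assume *: "\<not> ?thesis"
  then have "2 \<le> num_leaves l'" using num_leaves_pos[of l] by linarith
  then have "(k, k + num_leaves l') \<in> intervals k (Node l r)"
    using root_in_intervals[of l' k] assms(2) by auto
  moreover have "(k, k + num_leaves l') \<notin> intervals k l"
    "(k, k + num_leaves l') \<notin> intervals (k + num_leaves l) r"
    using * intervals_bounds(3)[of k "k + num_leaves l'" k l] num_leaves_pos[of l]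
      intervals_bounds(1)[of k "k + num_leaves l'" "k + num_leaves l" r] by auto
  ultimately show False using assms(1) num_leaves_pos[of r'] by auto
qed

lemma intervals_inject:
  assumes "num_leaves t = num_leaves t'" "intervals k t = intervals k t'"
  shows "t = t'"
  using assms
proof (induction t arbitrary: k t')
  case Leaf
  then show ?case by (cases t') auto
next
  case (Node l r)
  obtain l' r' where t': "t' = Node l' r'" using Node.prems(2) by (cases t') auto
  have l: "num_leaves l = num_leaves l'"
    using num_leaves_left_le[of l r l' r' k] num_leaves_left_le[of l' r' l r k] Node.prems
    unfolding t' by (intro antisym) (simp_all only: order.refl)
  then have r: "num_leaves r = num_leaves r'" using Node.prems(1) t' by simp
  have "intervals k l = intervals k l'"
    unfolding intervals_left[of k l r] intervals_left[of k l' r'] Node.prems(2)[unfolded t'] l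
    by (rule refl)
  moreover have "intervals (k + num_leaves l) r = intervals (k + num_leaves l') r'"
    using intervals_right[of k l r, unfolded Node.prems(2)[unfolded t']]
      intervals_right[of k l' r'] unfolding l by (simp only:)
  ultimately show ?case using Node.IH(1)[OF l] Node.IH(2)[OF r] l t' by simp
qed

lemma noncrossing_intervals_subset:
  "noncrossing_intervals G \<Longrightarrow> F \<subseteq> G \<Longrightarrow> noncrossing_intervals F"
  unfolding noncrossing_intervals_def by blast

text \<open>Only an inclusion is claimed, so \<open>F\<close> may be restricted freely to the two
  sides of the split. The entry \<open>k + 1\<close> in \<open>B\<close> covers the case where no
  proper interval starts at \<open>k\<close>; the left subtree then is a leaf.\<close>

lemma noncrossing_intervals_extend:
  assumes "k < j" "noncrossing_intervals F"
    and "\<And>a b. (a, b) \<in> F \<Longrightarrow> k \<le> a \<and> a + 2 \<le> b \<and> b \<le> j"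
  shows "\<exists>t. k + num_leaves t = j \<and> F \<subseteq> intervals k t"
  using assms
proof (induction "j - k" arbitrary: k j F rule: less_induct)
  case less
  show ?case
  proof (cases "j = k + 1")
    case True
    then have "F = {}" using less.prems(3) by fastforce
    then show ?thesis using True by (intro exI[of _ Leaf]) auto
  next
    case False
    text \<open>The longest interval starting at \<open>k\<close>, other than the whole of \<open>(k, j)\<close>, determines where
      the root of the tree has to split.\<close>
    define B where "B = insert (k + 1) {b. (k, b) \<in> F \<and> b < j}"
    define m where "m = Max B"
    have "finite B" unfolding B_def by auto
    then have mB: "m \<in> B" and mmax: "\<And>b. b \<in> B \<Longrightarrow> b \<le> m"
      unfolding m_def by (intro Max_in Max_ge; simp add: B_def)+
    have km: "k < m" and mj: "m < j"
      using mB less.prems(1) less.prems(3)[of k m] False unfolding B_def by auto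
    \<comment> \<open>An interval straddling \<open>m\<close> and starting at \<open>k\<close>
      contradicts the choice of \<open>m\<close> as maximum. If it starts later, then
      \<open>m > k + 1\<close>, so \<open>(k, m)\<close> is a member of \<open>F\<close> and is
      crossed by it.\<close>
    have split: "b \<le> m \<or> m \<le> a \<or> (a, b) = (k, j)" if ab: "(a, b) \<in> F" for a b
    proof (rule ccontr)
      assume *: "\<not> ?thesis"
      show False
      proof (cases "a = k")
        case True
        then have "b \<in> B" using * ab less.prems(3)[OF ab] by (auto simp: B_def)
        then show False using mmax * by force
      next
        case False
        then have "k < a" using less.prems(3)[OF ab] by simp
        then have km_in: "(k, m) \<in> F" using * mB unfolding B_def by auto
        then show False using noncrossing_intervalsD[OF less.prems(2) km_in ab] * \<open>k < a\<close> by auto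
      qed
    qed
    let ?L = "{(a, b) \<in> F. b \<le> m}" and ?R = "{(a, b) \<in> F. m \<le> a}"
    have "noncrossing_intervals ?L" "noncrossing_intervals ?R"
      by (rule noncrossing_intervals_subset[OF less.prems(2)], blast)+
    moreover have "\<And>a b. (a, b) \<in> ?L \<Longrightarrow> k \<le> a \<and> a + 2 \<le> b \<and> b \<le> m"
      "\<And>a b. (a, b) \<in> ?R \<Longrightarrow> m \<le> a \<and> a + 2 \<le> b \<and> b \<le> j"
      using less.prems(3) by auto
    ultimately obtain l r where l: "k + num_leaves l = m" "?L \<subseteq> intervals k l"
      and r: "m + num_leaves r = j" "?R \<subseteq> intervals m r"
      using less.hyps[of m k ?L] less.hyps[of j m ?R] km mj
      by (meson diff_less_mono diff_less_mono2 less_imp_le less_trans)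
    have "F \<subseteq> intervals k (Node l r)"
      using split l r by fastforce
    then show ?thesis using l r by (intro exI[of _ "Node l r"]) auto
  qed
qed

section \<open>Trees as triangulations\<close>

definition chord :: "nat \<times> nat \<Rightarrow> segment" where
  "chord = (\<lambda>(a, b). {a, b})"

lemma chord_eq_iff:
  "a < b \<Longrightarrow> c < d \<Longrightarrow> chord (a, b) = chord (c, d) \<longleftrightarrow> (a, b) = (c, d)"
  by (auto simp: chord_def doubleton_eq_iff)

lemma crosses_doubleton_iff:
  assumes "a < b" "c < d"
  shows "crosses {a, b} {c, d} \<longleftrightarrow> a < c \<and> c < b \<and> b < d \<or> c < a \<and> a < d \<and> d < b"
proof
  assume "crosses {a, b} {c, d}"
  then show "a < c \<and> c < b \<and> b < d \<or> c < a \<and> a < d \<and> d < b"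
    using assms unfolding crosses_def doubleton_eq_iff by (elim exE) linarith
next
  assume "a < c \<and> c < b \<and> b < d \<or> c < a \<and> a < d \<and> d < b"
  then show "crosses {a, b} {c, d}" unfolding crosses_def by blast
qed

text \<open>Ordered endpoints make \<open>chord\<close> injective here. The excluded pairs are the
  sides: neighbours, and the closing side from \<open>n\<close> back to \<open>0\<close>.\<close>

definition diagonal_intervals :: "nat \<Rightarrow> (nat \<times> nat) set" where
  "diagonal_intervals n = {(a, b). a + 2 \<le> b \<and> b \<le> n \<and> (a, b) \<noteq> (0, n)}"

lemma inj_on_chord: "inj_on chord (diagonal_intervals n)"
  by (auto intro!: inj_onI simp: diagonal_intervals_def chord_eq_iff)

lemma mem_sides_iff:
  assumes "a < b"
  shows "{a, b} \<in> sides (n + 1) \<longleftrightarrow> b \<le> n \<and> (b = a + 1 \<or> (a, b) = (0, n))"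
proof
  assume "{a, b} \<in> sides (n + 1)"
  then obtain i where i: "i < n + 1" "{a, b} = {i, Suc i mod (n + 1)}" unfolding sides_def by blast
  then show "b \<le> n \<and> (b = a + 1 \<or> (a, b) = (0, n))"
    using assms by (cases "i = n") (auto simp: doubleton_eq_iff)
next
  assume *: "b \<le> n \<and> (b = a + 1 \<or> (a, b) = (0, n))"
  show "{a, b} \<in> sides (n + 1)"
  proof (cases "b = a + 1")
    case True
    then show ?thesis using * unfolding sides_def by (auto intro!: exI[of _ a])
  next
    case False
    then show ?thesis using * unfolding sides_def by (auto intro!: exI[of _ n])
  qed
qed

lemma diagonals_eq: "diagonals (n + 1) = chord ` diagonal_intervals n"
proof -
  have "diagonals (n + 1) = {{a, b} | a b. a < b \<and> b \<le> n} - sides (n + 1)"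
  proof -
    have "{{a, b} | a b. a < n + 1 \<and> b < n + 1 \<and> a \<noteq> b} = {{a, b} | a b. a < b \<and> b \<le> n}"
      by (fastforce simp: doubleton_eq_iff nat_neq_iff)
    then show ?thesis by (simp add: diagonals_def)
  qed
  also have "\<dots> = {{a, b} | a b. a < b \<and> b \<le> n \<and> {a, b} \<notin> sides (n + 1)}" by blast
  also have "\<dots> = {{a, b} | a b. (a, b) \<in> diagonal_intervals n}"
  proof -
    have "a < b \<and> b \<le> n \<and> {a, b} \<notin> sides (n + 1) \<longleftrightarrow> (a, b) \<in> diagonal_intervals n" for a b
      using mem_sides_iff[of a b n] by (auto simp: diagonal_intervals_def)
    then show ?thesis by simp
  qed
  also have "\<dots> = chord ` diagonal_intervals n" by (force simp: chord_def)
  finally show ?thesis .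
qed

lemma noncrossing_chord_iff:
  assumes "F \<subseteq> diagonal_intervals n"
  shows "noncrossing (chord ` F) \<longleftrightarrow> noncrossing_intervals F"
proof -
  have "a < b" if "(a, b) \<in> F" for a b using assms that by (auto simp: diagonal_intervals_def)
  then show ?thesis
    unfolding noncrossing_def noncrossing_intervals_def
    by (fastforce simp: chord_def crosses_doubleton_iff)
qed

definition tree_diagonals :: "plane_tree \<Rightarrow> segment set" where
  "tree_diagonals t = chord ` (intervals 0 t - {(0, num_leaves t)})"

lemma nonroot_intervals_subset:
  "intervals 0 t - {(0, num_leaves t)} \<subseteq> diagonal_intervals (num_leaves t)"
  using intervals_bounds[of _ _ 0 t] by (auto simp: diagonal_intervals_def)

text \<open>Allows the root interval, which a set of diagonals lacks, to be put back before
  maximality of tree intervals is invoked.\<close>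

lemma noncrossing_intervals_insert_root:
  assumes "noncrossing_intervals F" "\<And>a b. (a, b) \<in> F \<Longrightarrow> b \<le> n"
  shows "noncrossing_intervals (insert (0, n) F)"
  using assms unfolding noncrossing_intervals_def by fastforce

lemma triangulation_tree_diagonals:
  assumes n: "num_leaves t = n"
  shows "triangulation (n + 1) (tree_diagonals t)"
proof -
  let ?I = "intervals 0 t - {(0, n)}"
  have sub: "?I \<subseteq> diagonal_intervals n" using nonroot_intervals_subset n by blast
  have eq: "tree_diagonals t = chord ` ?I" using n by (simp add: tree_diagonals_def)
  have "T' = tree_diagonals t"
    if T': "T' \<subseteq> diagonals (n + 1)" "noncrossing T'" "tree_diagonals t \<subseteq> T'" for T'
  proof -
    obtain F where F: "F \<subseteq> diagonal_intervals n" "T' = chord ` F"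
      using T'(1) unfolding diagonals_eq by (meson subset_image_iff)
    have nc: "noncrossing_intervals F" using T'(2) noncrossing_chord_iff[OF F(1)] F(2) by simp
    have "?I \<subseteq> F"
    proof
      fix e assume e: "e \<in> ?I"
      then have "chord e \<in> chord ` F" using T'(3) F(2) eq by auto
      then show "e \<in> F" using inj_on_image_mem_iff[OF inj_on_chord _ F(1)] e sub by blast
    qed
    moreover have "(a, b) \<in> ?I" if ab: "(a, b) \<in> F" for a b
    proof -
      have b: "a + 2 \<le> b" "b \<le> n" "(a, b) \<noteq> (0, n)"
        using F(1) ab by (auto simp: diagonal_intervals_def)
      have "noncrossing_intervals (insert (0, n) F)"
        using F(1) by (intro noncrossing_intervals_insert_root nc) (auto simp: diagonal_intervals_def)
      \<comment> \<open>All intervals of \<open>t\<close> other than the root lie in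
        \<open>F\<close>, so this is a subfamily of \<open>F\<close> with the root added.\<close>
      then have "noncrossing_intervals (insert (a, b) (intervals 0 t))"
        by (rule noncrossing_intervals_subset) (use \<open>?I \<subseteq> F\<close> ab in auto)
      then show ?thesis using intervals_maximal[of 0 a b t] b n by auto
    qed
    ultimately have "F = ?I" by auto
    then show ?thesis using F eq by simp
  qed
  moreover have "tree_diagonals t \<subseteq> diagonals (n + 1)" using eq sub diagonals_eq by auto
  moreover have "noncrossing (tree_diagonals t)"
    using noncrossing_chord_iff[OF sub] eq
      noncrossing_intervals_subset[OF noncrossing_intervals_tree[of 0 t], of ?I] by auto
  ultimately show ?thesis unfolding triangulation_def by blast
qed

lemma triangulation_eq_tree_diagonals:
  assumes T: "triangulation (n + 1) T" and "n \<ge> 2"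
  obtains t where "num_leaves t = n" "tree_diagonals t = T"
proof -
  obtain F where F: "F \<subseteq> diagonal_intervals n" "T = chord ` F"
    using T unfolding diagonals_eq triangulation_def by (meson subset_image_iff)
  have nc: "noncrossing_intervals F"
    using T noncrossing_chord_iff[OF F(1)] unfolding F(2) triangulation_def by simp
  obtain t where t: "num_leaves t = n" "F \<subseteq> intervals 0 t"
    using noncrossing_intervals_extend[of 0 n F] F(1) nc assms(2)
    by (auto simp: diagonal_intervals_def)
  have "T \<subseteq> tree_diagonals t"
    using F t by (auto simp: tree_diagonals_def diagonal_intervals_def)
  then have "tree_diagonals t = T"
    using T triangulation_tree_diagonals[OF t(1)] unfolding triangulation_def by blast
  with t that show ?thesis by blast
qed

lemma tree_diagonals_inject:
  assumes "num_leaves t = n" "num_leaves u = n" "tree_diagonals t = tree_diagonals u" "n \<ge> 2"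
  shows "t = u"
proof -
  have "intervals 0 t - {(0, n)} = intervals 0 u - {(0, n)}"
    using inj_on_image_eq_iff[OF inj_on_chord[of n]] nonroot_intervals_subset[of t]
      nonroot_intervals_subset[of u] assms by (metis tree_diagonals_def)
  moreover have "(0, n) \<in> intervals 0 t" "(0, n) \<in> intervals 0 u"
    using root_in_intervals[of t 0] root_in_intervals[of u 0] assms by auto
  ultimately have "intervals 0 t = intervals 0 u" by blast
  then show ?thesis using intervals_inject assms by metis
qed

section \<open>Rotations as flips\<close>

text \<open>The possible edges of the quadrilateral around a diagonal: a leaf gives a side of the
  polygon, an internal vertex gives a diagonal or the side of the root.\<close>

definition leaf_or_interval :: "(nat \<times> nat) set \<Rightarrow> nat \<Rightarrow> nat \<Rightarrow> bool" where
  "leaf_or_interval F a b \<longleftrightarrow> b = a + 1 \<or> (a, b) \<in> F"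

text \<open>\<open>interval_flip F e e'\<close>: the interval \<open>e\<close> is a left or a right child whose parent, sibling and
  children are intervals in \<open>F\<close> or single leaves, and \<open>e'\<close> replaces it in the rotation at \<open>e\<close>.\<close>

inductive interval_flip :: "(nat \<times> nat) set \<Rightarrow> nat \<times> nat \<Rightarrow> nat \<times> nat \<Rightarrow> bool" for F where
  left_child: "interval_flip F (a, b) (c, d)"
    if "a < c" "c < b" "b < d"
      "leaf_or_interval F a c" "leaf_or_interval F c b"
      "leaf_or_interval F b d" "leaf_or_interval F a d"
| right_child: "interval_flip F (a, b) (d, c)"
    if "d < a" "a < c" "c < b"
      "leaf_or_interval F a c" "leaf_or_interval F c b"
      "leaf_or_interval F d b" "leaf_or_interval F d a"

lemma leaf_or_interval_mono: "leaf_or_interval F a b \<Longrightarrow> F \<subseteq> G \<Longrightarrow> leaf_or_interval G a b"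
  by (auto simp: leaf_or_interval_def)

lemma interval_flip_mono: "interval_flip F e e' \<Longrightarrow> F \<subseteq> G \<Longrightarrow> interval_flip G e e'"
  by (erule interval_flip.cases)
    (simp_all add: interval_flip.intros leaf_or_interval_mono)

lemma leaf_or_interval_root:
  "intervals k t \<subseteq> F \<Longrightarrow> leaf_or_interval F k (k + num_leaves t)"
  by (cases t) (auto simp: leaf_or_interval_def add.assoc)

lemma num_leaves_rotate_at [simp]: "num_leaves (rotate_at p t) = num_leaves t"
  by (induction p t rule: rotate_at.induct) auto

lemma root_notin_subtrees:
  "(k, k + num_leaves l + num_leaves r) \<notin> intervals k l"
  "(k, k + num_leaves l + num_leaves r) \<notin> intervals (k + num_leaves l) r"
  using intervals_bounds(3)[of k "k + num_leaves l + num_leaves r" k l] num_leaves_pos[of r]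
    intervals_bounds(1)[of k "k + num_leaves l + num_leaves r" "k + num_leaves l" r]
    num_leaves_pos[of l] by auto

lemma intervals_disjoint:
  assumes "j \<ge> k + num_leaves l"
  shows "intervals k l \<inter> intervals j r = {}"
proof -
  have False if "e \<in> intervals k l" "e \<in> intervals j r" for e
    using that intervals_bounds(2,3)[of "fst e" "snd e" k l]
      intervals_bounds(1)[of "fst e" "snd e" j r] assms by simp
  then show ?thesis by blast
qed

text \<open>With consecutive leaf blocks A, B, C, rotation at a left child exchanges the interval of
  A and B for that of B and C and keeps all others. Deeper down, the replaced interval belongs to
  one subtree only, so the rest of the family is unaffected.\<close>

lemma rotate_at_interval_flip:
  assumes "p \<in> internal_vertices t" "p \<noteq> []"
  shows "\<exists>e'. interval_flip (intervals k t) (interval k t p) e' \<and>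
    intervals k (rotate_at p t) = insert e' (intervals k t - {interval k t p})"
  using assms
proof (induction p t arbitrary: k rule: rotate_at.induct)
  case (1 a b c)
  let ?a = "k + num_leaves a" and ?b = "k + num_leaves a + num_leaves b"
  have "intervals k (rotate_at [Left] (Node (Node a b) c)) =
      insert (?a, ?b + num_leaves c) (intervals k (Node (Node a b) c) - {(k, ?b)})"
    using root_notin_subtrees[of k a b] intervals_bounds(1)[of k ?b ?b c] num_leaves_pos[of a]
    by (auto simp: add.assoc)
  moreover have "interval_flip (intervals k (Node (Node a b) c)) (k, ?b) (?a, ?b + num_leaves c)"
  proof (rule left_child)
    let ?F = "intervals k (Node (Node a b) c)"
    show "leaf_or_interval ?F k ?a" "leaf_or_interval ?F ?a ?b"
      "leaf_or_interval ?F ?b (?b + num_leaves c)"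
      by (rule leaf_or_interval_root, force simp: add.assoc)+
    show "leaf_or_interval ?F k (?b + num_leaves c)" by (simp add: leaf_or_interval_def)
  qed simp_all
  ultimately show ?case by (intro exI[of _ "(?a, ?b + num_leaves c)"]) (simp add: add.assoc)
next
  case (2 c a b)
  let ?c = "k + num_leaves c" and ?a = "k + num_leaves c + num_leaves a"
  have "intervals k (rotate_at [Right] (Node c (Node a b))) =
      insert (k, ?a) (intervals k (Node c (Node a b)) - {(?c, ?a + num_leaves b)})"
    using root_notin_subtrees[of ?c a b] intervals_bounds(3)[of ?c "?a + num_leaves b" k c]
      num_leaves_pos[of c]
    by (auto simp: add.assoc)
  moreover have "interval_flip (intervals k (Node c (Node a b))) (?c, ?a + num_leaves b) (k, ?a)"
  proof (rule right_child)
    let ?F = "intervals k (Node c (Node a b))"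
    show "leaf_or_interval ?F ?c ?a" "leaf_or_interval ?F ?a (?a + num_leaves b)"
      "leaf_or_interval ?F k ?c"
      by (rule leaf_or_interval_root, force simp: add.assoc)+
    show "leaf_or_interval ?F k (?a + num_leaves b)" by (simp add: leaf_or_interval_def add.assoc)
  qed simp_all
  ultimately show ?case by (intro exI[of _ "(k, ?a)"]) (simp add: add.assoc)
next
  case (3 s p l r)
  let ?q = "s # p"
  have q: "?q \<in> internal_vertices l" using "3.prems" by auto
  then obtain e' where e': "interval_flip (intervals k l) (interval k l ?q) e'"
    "intervals k (rotate_at ?q l) = insert e' (intervals k l - {interval k l ?q})"
    using "3.IH"[of k] by auto
  have e: "interval k l ?q \<in> intervals k l" by (rule interval_in_intervals[OF q])
  then have "interval k l ?q \<notin> intervals (k + num_leaves l) r"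
    "interval k l ?q \<noteq> (k, k + num_leaves l + num_leaves r)"
    using intervals_disjoint[of k l "k + num_leaves l" r] root_notin_subtrees(1)[of k l r] by auto
  moreover have "interval_flip (intervals k (Node l r)) (interval k l ?q) e'"
    using e'(1) by (rule interval_flip_mono) auto
  moreover have "intervals k (rotate_at (Left # ?q) (Node l r)) =
      insert e' (intervals k (Node l r) - {interval k l ?q})"
    unfolding rotate_at.simps intervals_simps e'(2) num_leaves_rotate_at using calculation(1,2) by blast
  ultimately show ?case unfolding interval.simps by blast
next
  case (4 s p l r)
  let ?q = "s # p" and ?m = "k + num_leaves l"
  have q: "?q \<in> internal_vertices r" using "4.prems" by auto
  then obtain e' where e': "interval_flip (intervals ?m r) (interval ?m r ?q) e'"
    "intervals ?m (rotate_at ?q r) = insert e' (intervals ?m r - {interval ?m r ?q})"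
    using "4.IH"[of ?m] by auto
  have e: "interval ?m r ?q \<in> intervals ?m r" by (rule interval_in_intervals[OF q])
  then have "interval ?m r ?q \<notin> intervals k l"
    "interval ?m r ?q \<noteq> (k, ?m + num_leaves r)"
    using intervals_disjoint[of k l ?m r] root_notin_subtrees(2)[of k l r] by auto
  moreover have "interval_flip (intervals k (Node l r)) (interval ?m r ?q) e'"
    using e'(1) by (rule interval_flip_mono) auto
  moreover have "intervals k (rotate_at (Right # ?q) (Node l r)) =
      insert e' (intervals k (Node l r) - {interval ?m r ?q})"
    unfolding rotate_at.simps intervals_simps e'(2) num_leaves_rotate_at using calculation(1,2) by blast
  ultimately show ?case unfolding interval.simps by blast
qed auto

definition diagonal_at :: "plane_tree \<Rightarrow> vertex \<Rightarrow> segment" where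
  "diagonal_at t p = chord (interval 0 t p)"

lemma tree_diagonals_eq: "tree_diagonals t = diagonal_at t ` (internal_vertices t - {[]})"
  using image_interval_nonroot[of 0 t] by (simp add: tree_diagonals_def diagonal_at_def flip: image_image)

lemma other_diagonalI:
  assumes "{a, b} \<in> T" "crosses {a, b} {c, d}"
    and "{a, c} \<in> T - {{a, b}} \<union> sides m" "{c, b} \<in> T - {{a, b}} \<union> sides m"
    and "{b, d} \<in> T - {{a, b}} \<union> sides m" "{d, a} \<in> T - {{a, b}} \<union> sides m"
  shows "other_diagonal m T {a, b} {c, d}"
  unfolding other_diagonal_def
  by (intro conjI exI[of _ a] exI[of _ b] exI[of _ c] exI[of _ d]) (use assms in simp_all)

lemma interval_flip_other_diagonal:
  assumes flip: "interval_flip (intervals 0 t) e e'" and e: "e \<in> intervals 0 t"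
    and n: "num_leaves t = n" and root: "e \<noteq> (0, n)"
  shows "other_diagonal (n + 1) (tree_diagonals t) (chord e) (chord e')"
proof -
  \<comment> \<open>Serves all four edges of the quadrilateral; the parent of \<open>e\<close> may
    be the root, whose chord is a side.\<close>
  have edge: "{x, y} \<in> tree_diagonals t - {chord e} \<union> sides (n + 1)"
    if "leaf_or_interval (intervals 0 t) x y" "(x, y) \<noteq> e" "x < y" "y \<le> n" for x y
  proof (cases "y = x + 1 \<or> (x, y) = (0, n)")
    case True
    then show ?thesis using mem_sides_iff[of x y n] that by auto
  next
    case False
    then have "{x, y} \<in> tree_diagonals t"
      using that n by (auto simp: tree_diagonals_def chord_def leaf_or_interval_def)
    moreover have "{x, y} \<noteq> chord e"
      using chord_eq_iff[of x y "fst e" "snd e"] intervals_bounds(2)[of "fst e" "snd e" 0 t] e that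
      by (auto simp: chord_def)
    ultimately show ?thesis by blast
  qed
  have le: "b \<le> n" if "(a, b) \<in> intervals 0 t" for a b
    using intervals_bounds(3)[OF that] n by simp
  have mem: "chord e \<in> tree_diagonals t" using e root n by (simp add: tree_diagonals_def)
  from flip show ?thesis
  proof cases
    case (left_child a c b d)
    then have "d \<le> n" using le[of a d] by (auto simp: leaf_or_interval_def)
    have "other_diagonal (n + 1) (tree_diagonals t) {a, b} {c, d}"
    proof (rule other_diagonalI)
      show "crosses {a, b} {c, d}" using left_child by (subst crosses_doubleton_iff) auto
      show "{a, b} \<in> tree_diagonals t" using mem left_child(1) by (simp add: chord_def)
    qed (use edge[OF left_child(6)] edge[OF left_child(7)] edge[OF left_child(8)]
        edge[OF left_child(9)] left_child(1-5) \<open>d \<le> n\<close> in \<open>simp_all add: chord_def insert_commute\<close>)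
    then show ?thesis using left_child(1,2) by (simp add: chord_def)
  next
    case (right_child d a c b)
    have "b \<le> n" using le[of a b] e right_child(1) by auto
    have "other_diagonal (n + 1) (tree_diagonals t) {a, b} {c, d}"
    proof (rule other_diagonalI)
      show "crosses {a, b} {c, d}"
        using right_child by (subst insert_commute[of c], subst crosses_doubleton_iff) auto
      show "{a, b} \<in> tree_diagonals t" using mem right_child(1) by (simp add: chord_def)
    qed (use edge[OF right_child(6)] edge[OF right_child(7)] edge[OF right_child(8)]
        edge[OF right_child(9)] right_child(1-5) \<open>b \<le> n\<close> in \<open>simp_all add: chord_def insert_commute\<close>)
    then show ?thesis using right_child(1,2) by (simp add: chord_def insert_commute)
  qed
qed

text \<open>The replaced interval is never the root's: it starts strictly after its parent or ends
  strictly before it.\<close>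

lemma interval_flip_new:
  assumes "interval_flip F e e'" "F \<subseteq> {(a, b). a + 2 \<le> b \<and> b \<le> n}" "e \<in> F"
  shows "e' \<in> diagonal_intervals n"
  using assms(1)
proof cases
  case (left_child a c b d)
  then show ?thesis using assms(2,3) by (auto simp: diagonal_intervals_def leaf_or_interval_def)
next
  case (right_child d a c b)
  then show ?thesis using assms(2,3) by (auto simp: diagonal_intervals_def leaf_or_interval_def)
qed

lemma rotate_at_flip:
  assumes "num_leaves t = n" "w \<in> internal_vertices t" "w \<noteq> []"
  obtains e' where "other_diagonal (n + 1) (tree_diagonals t) (diagonal_at t w) e'"
    "tree_diagonals (rotate_at w t) = exchange (diagonal_at t w) e' (tree_diagonals t)"
proof -
  let ?e = "interval 0 t w" and ?I = "intervals 0 t - {(0, n)}"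
  obtain e' where e': "interval_flip (intervals 0 t) ?e e'"
    "intervals 0 (rotate_at w t) = insert e' (intervals 0 t - {?e})"
    using rotate_at_interval_flip[OF assms(2,3)] by blast
  have e: "?e \<in> intervals 0 t" "?e \<noteq> (0, n)"
    using interval_in_intervals[OF assms(2)] interval_eq_root_iff[OF assms(2), of 0] assms by auto
  have sub: "?I \<subseteq> diagonal_intervals n" using nonroot_intervals_subset[of t] assms(1) by simp
  have "intervals 0 t \<subseteq> {(a, b). a + 2 \<le> b \<and> b \<le> n}"
    using intervals_bounds(2,3)[of _ _ 0 t] assms(1) by auto
  then have "e' \<in> diagonal_intervals n" using interval_flip_new e'(1) e(1) by blast
  then have "e' \<noteq> (0, n)" by (auto simp: diagonal_intervals_def)
  then have "intervals 0 (rotate_at w t) - {(0, n)} = insert e' (?I - {?e})"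
    using e'(2) by auto
  then have "tree_diagonals (rotate_at w t) = insert (chord e') (chord ` (?I - {?e}))"
    by (simp add: tree_diagonals_def assms(1))
  \<comment> \<open>Deleting an interval deletes exactly one chord, by injectivity of
    \<open>chord\<close>.\<close>
  also have "chord ` (?I - {?e}) = chord ` ?I - {chord ?e}"
    using inj_on_image_set_diff[OF inj_on_chord[of n], of ?I "{?e}"] sub e by auto
  finally have "tree_diagonals (rotate_at w t) = exchange (diagonal_at t w) (chord e') (tree_diagonals t)"
    by (simp add: exchange_def diagonal_at_def tree_diagonals_def assms(1))
  moreover have "other_diagonal (n + 1) (tree_diagonals t) (diagonal_at t w) (chord e')"
    using interval_flip_other_diagonal[OF e'(1) e(1) assms(1) e(2)] by (simp add: diagonal_at_def)
  ultimately show ?thesis using that by blast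
qed

section \<open>Uniqueness of the flipped diagonal\<close>

text \<open>A side has no vertex of the polygon strictly on one of its two sides. Edges of a
  quadrilateral may be sides, so the uniqueness argument needs noncrossing for them too.\<close>

lemma noncrossing_Un_sides:
  assumes "T \<subseteq> diagonals (n + 1)" "noncrossing T"
  shows "noncrossing (T \<union> sides (n + 1))"
proof -
  have side: "(b = a + 1 \<and> b \<le> n) \<or> (a = 0 \<and> b = n)" if "{a, b} \<in> sides (n + 1)" "a < b" for a b
    using mem_sides_iff that by auto
  have bound: "x \<le> n" if "e \<in> T \<union> sides (n + 1)" "x \<in> e" for e x
    using that assms(1) unfolding diagonals_eq
    by (auto simp: sides_def diagonal_intervals_def chord_def less_Suc_eq_le)
  have "\<not> crosses e f" if ef: "e \<in> T \<union> sides (n + 1)" "f \<in> T \<union> sides (n + 1)" for e f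
  proof
    assume cross: "crosses e f"
    then obtain a b c d where abcd: "a < c" "c < b" "b < d"
      "e = {a, b} \<and> f = {c, d} \<or> e = {c, d} \<and> f = {a, b}"
      unfolding crosses_def by blast
    have "d \<le> n" using abcd(4) bound[OF ef(1), of d] bound[OF ef(2), of d] by auto
    then have "{a, b} \<notin> sides (n + 1)" "{c, d} \<notin> sides (n + 1)"
      using side[of a b] side[of c d] abcd by auto
    then have "e \<in> T" "f \<in> T" using abcd(4) ef by auto
    then show False using cross assms(2) unfolding noncrossing_def by blast
  qed
  then show ?thesis unfolding noncrossing_def by blast
qed

text \<open>Breaks the symmetry of unordered endpoints: \<open>c\<close> is the apex between
  \<open>a\<close> and \<open>b\<close>, and \<open>d\<close> the apex on the other side of the
  diagonal.\<close>

lemma other_diagonal_ordered: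
  assumes "other_diagonal m T e e'" "e = {a, b}" "a < b"
  obtains c d where "e' = {c, d}" "a < c" "c < b" "d < a \<or> b < d"
    "{{a, c}, {c, b}, {b, d}, {d, a}} \<subseteq> T \<union> sides m"
proof -
  obtain x x' y y' where *: "e = {x, y}" "e' = {x', y'}" "crosses e e'"
    "{{x, x'}, {x', y}, {y, y'}, {y', x}} \<subseteq> T \<union> sides m"
  proof -
    from assms(1) show ?thesis
      unfolding other_diagonal_def by (elim conjE exE) (rule that, assumption+, blast)
  qed
  have xy: "{{a, x'}, {x', b}, {b, y'}, {y', a}} \<subseteq> T \<union> sides m"
    using * assms(2) by (auto simp: doubleton_eq_iff insert_commute)
  have "a < x' \<and> x' < b \<and> (y' < a \<or> b < y') \<or> a < y' \<and> y' < b \<and> (x' < a \<or> b < x')"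
  proof (cases "x' < y'")
    case True
    then show ?thesis using *(2,3) assms(2,3) crosses_doubleton_iff[of a b x' y'] by auto
  next
    case False
    have "x' \<noteq> y'" using *(2,3) unfolding crosses_def by (auto simp: doubleton_eq_iff)
    then show ?thesis
      using False *(2,3) assms(2,3) crosses_doubleton_iff[of a b y' x'] by (auto simp: insert_commute)
  qed
  then show ?thesis
  proof
    assume "a < x' \<and> x' < b \<and> (y' < a \<or> b < y')"
    then show ?thesis using that[of x' y'] xy *(2) by blast
  next
    assume "a < y' \<and> y' < b \<and> (x' < a \<or> b < x')"
    then show ?thesis using that[of y' x'] xy *(2) by (simp add: insert_commute)
  qed
qed

text \<open>Two different other diagonals would make two sides of the two quadrilaterals cross.\<close>

lemma other_diagonal_unique:
  assumes T: "triangulation (n + 1) T"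
    and "other_diagonal (n + 1) T e f" "other_diagonal (n + 1) T e g"
  shows "f = g"
proof -
  let ?S = "T \<union> sides (n + 1)"
  have "e \<in> diagonals (n + 1)"
    using T assms(2) unfolding triangulation_def other_diagonal_def by blast
  then obtain a b where ab: "e = {a, b}" "a < b"
    unfolding diagonals_eq by (auto simp: diagonal_intervals_def chord_def)
  have nc: False if "{x, y} \<in> ?S" "{u, v} \<in> ?S" "x < u" "u < y" "y < v" for x y u v
  proof -
    have "crosses {x, y} {u, v}" using that(3-5) unfolding crosses_def by blast
    moreover have "noncrossing ?S" using noncrossing_Un_sides T unfolding triangulation_def by simp
    ultimately show False using that(1,2) unfolding noncrossing_def by blast
  qed
  obtain c d where f: "f = {c, d}" "a < c" "c < b" "d < a \<or> b < d"
    "{{a, c}, {c, b}, {b, d}, {d, a}} \<subseteq> ?S"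
    using other_diagonal_ordered[OF assms(2) ab] by metis
  obtain c' d' where g: "g = {c', d'}" "a < c'" "c' < b" "d' < a \<or> b < d'"
    "{{a, c'}, {c', b}, {b, d'}, {d', a}} \<subseteq> ?S"
    using other_diagonal_ordered[OF assms(3) ab] by metis
  have S: "{a, c} \<in> ?S" "{c, b} \<in> ?S" "{b, d} \<in> ?S" "{d, a} \<in> ?S" "{d, b} \<in> ?S" "{a, d} \<in> ?S"
    "{a, c'} \<in> ?S" "{c', b} \<in> ?S" "{b, d'} \<in> ?S" "{d', a} \<in> ?S" "{d', b} \<in> ?S" "{a, d'} \<in> ?S"
    using f(5) g(5) by (auto simp: insert_commute)
  have "c = c'"
    using nc[OF S(2) S(7)] nc[OF S(8) S(1)] nc[OF S(1) S(8)] nc[OF S(7) S(2)] f g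
    by (metis linorder_neqE_nat)
  moreover have "d = d'"
  proof (rule ccontr)
    assume "d \<noteq> d'"
    \<comment> \<open>The outer apexes may lie both beyond \<open>b\<close>, on different ends, or
      both before \<open>a\<close>; each case yields its own crossing pair of quadrilateral
      edges.\<close>
    then consider "b < d" "d < d'" | "b < d'" "d' < d" | "d < a" "b < d'" | "d' < a" "b < d"
      | "d < d'" "d' < a" | "d' < d" "d < a"
      using f(4) g(4) by linarith
    then show False
      using nc[OF S(6) S(9)] nc[OF S(12) S(3)] nc[OF S(5) S(12)] nc[OF S(11) S(6)]
        nc[OF S(4) S(11)] nc[OF S(10) S(5)] ab(2)
      by cases auto
  qed
  ultimately show ?thesis using f g by simp
qed

text \<open>Rotation at the vertex carrying \<open>e\<close> flips \<open>e\<close> to some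
  diagonal, which uniqueness identifies with \<open>e'\<close>.\<close>

lemma other_diagonal_rotate_at:
  assumes t: "num_leaves t = n" and od: "other_diagonal (n + 1) (tree_diagonals t) e e'"
  obtains w where "w \<in> internal_vertices t" "w \<noteq> []" "diagonal_at t w = e"
    "tree_diagonals (rotate_at w t) = exchange e e' (tree_diagonals t)"
proof -
  have "e \<in> tree_diagonals t" using od by (simp add: other_diagonal_def)
  then obtain w where w: "w \<in> internal_vertices t" "w \<noteq> []" "diagonal_at t w = e"
    unfolding tree_diagonals_eq by auto
  obtain f where f: "other_diagonal (n + 1) (tree_diagonals t) e f"
    "tree_diagonals (rotate_at w t) = exchange e f (tree_diagonals t)"
    using rotate_at_flip[OF t w(1,2)] w(3) by metis
  have "f = e'" using other_diagonal_unique[OF triangulation_tree_diagonals[OF t] f(1) od] .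
  then show ?thesis using that w f by blast
qed

section \<open>Layouts as pairs of triangulations\<close>

lemma proper_subtanglegram_iff:
  "proper_subtanglegram (P1, P2) u v \<longleftrightarrow>
     u \<in> internal_vertices P1 \<and> u \<noteq> [] \<and> v \<in> internal_vertices P2 \<and> v \<noteq> [] \<and>
     diagonal_at P1 u = diagonal_at P2 v"
proof -
  have "diagonal_at P1 u = diagonal_at P2 v \<longleftrightarrow> leaf_descendants P1 u = leaf_descendants P2 v"
    if "u \<in> internal_vertices P1" "v \<in> internal_vertices P2"
  proof -
    have "fst (interval 0 P1 u) < snd (interval 0 P1 u)"
      "fst (interval 0 P2 v) < snd (interval 0 P2 v)"
      using intervals_bounds(2)[of "fst (interval 0 P1 u)" "snd (interval 0 P1 u)" 0 P1]
        intervals_bounds(2)[of "fst (interval 0 P2 v)" "snd (interval 0 P2 v)" 0 P2]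
        that interval_in_intervals by auto
    then show ?thesis
      using chord_eq_iff[of "fst (interval 0 P1 u)" "snd (interval 0 P1 u)"
          "fst (interval 0 P2 v)" "snd (interval 0 P2 v)"] leaf_descendants_eq_iff[OF that]
      by (simp add: diagonal_at_def)
  qed
  then show ?thesis by (auto simp: proper_subtanglegram_def)
qed

lemma irreducible_layout_iff:
  "irreducible_layout (P1, P2) \<longleftrightarrow> tree_diagonals P1 \<inter> tree_diagonals P2 = {}"
  unfolding irreducible_layout_def proper_subtanglegram_iff tree_diagonals_eq
  by (auto simp: disjoint_iff)

definition layout_diagonals :: "layout \<Rightarrow> triangulation_pair" where
  "layout_diagonals = map_prod tree_diagonals tree_diagonals"

lemma bij_betw_layout_diagonals:
  assumes "n \<ge> 2"
  shows "bij_betw layout_diagonals (irreducible_layouts n) (disjoint_triangulations (n + 1))"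
proof (rule bij_betw_imageI)
  show "inj_on layout_diagonals (irreducible_layouts n)"
    using tree_diagonals_inject[OF _ _ _ assms]
    by (auto intro!: inj_onI simp: irreducible_layouts_def layout_diagonals_def)
  show "layout_diagonals ` irreducible_layouts n = disjoint_triangulations (n + 1)"
  proof
    show "layout_diagonals ` irreducible_layouts n \<subseteq> disjoint_triangulations (n + 1)"
      using triangulation_tree_diagonals[of _ n]
      by (auto simp: irreducible_layouts_def disjoint_triangulations_def layout_diagonals_def
          irreducible_layout_iff)
    show "disjoint_triangulations (n + 1) \<subseteq> layout_diagonals ` irreducible_layouts n"
    proof
      fix S assume "S \<in> disjoint_triangulations (n + 1)"
      then obtain T1 T2 where S: "S = (T1, T2)" "triangulation (n + 1) T1"
        "triangulation (n + 1) T2" "T1 \<inter> T2 = {}"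
        by (auto simp: disjoint_triangulations_def)
      obtain P1 P2 where P: "num_leaves P1 = n" "tree_diagonals P1 = T1"
        "num_leaves P2 = n" "tree_diagonals P2 = T2"
        using triangulation_eq_tree_diagonals[OF _ assms] S by metis
      then have "(P1, P2) \<in> irreducible_layouts n"
        using S by (simp add: irreducible_layouts_def irreducible_layout_iff)
      then show "S \<in> layout_diagonals ` irreducible_layouts n"
        using P S by (intro image_eqI[of _ _ "(P1, P2)"]) (auto simp: layout_diagonals_def)
    qed
  qed
qed

section \<open>Single and double moves on pairs\<close>

lemma diagonal_at_in_tree_diagonals:
  "w \<in> internal_vertices t \<Longrightarrow> w \<noteq> [] \<Longrightarrow> diagonal_at t w \<in> tree_diagonals t"
  by (simp add: tree_diagonals_eq)

text \<open>An arbitrary set \<open>D\<close> stands for the diagonals of the other tree, so both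
  coordinates are served.\<close>

lemma single_rotation_flip:
  assumes "num_leaves P = n" "w \<in> internal_vertices P" "w \<noteq> []"
    and "tree_diagonals (rotate_at w P) \<inter> D = {}"
  obtains e e' where "other_diagonal (n + 1) (tree_diagonals P) e e'" "e' \<notin> D"
    "tree_diagonals (rotate_at w P) = exchange e e' (tree_diagonals P)"
  by (rule rotate_at_flip[OF assms(1-3)]) (use that assms(4) in \<open>auto simp: exchange_def\<close>)

lemma double_rotation_flip:
  assumes "num_leaves P = n" "num_leaves Q = n" "tree_diagonals P \<inter> tree_diagonals Q = {}"
    and "w \<in> internal_vertices P" "w \<noteq> []"
    and "u \<in> internal_vertices (rotate_at w P)" "u \<noteq> []"
    and "v \<in> internal_vertices Q" "v \<noteq> []"
    and "diagonal_at (rotate_at w P) u = diagonal_at Q v"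
  obtains e e' e'' where "other_diagonal (n + 1) (tree_diagonals P) e e'"
    "e' \<in> tree_diagonals Q" "other_diagonal (n + 1) (tree_diagonals Q) e' e''"
    "tree_diagonals (rotate_at w P) = exchange e e' (tree_diagonals P)"
    "tree_diagonals (rotate_at v Q) = exchange e' e'' (tree_diagonals Q)"
proof -
  obtain e' where e': "other_diagonal (n + 1) (tree_diagonals P) (diagonal_at P w) e'"
    "tree_diagonals (rotate_at w P) = exchange (diagonal_at P w) e' (tree_diagonals P)"
    using rotate_at_flip[OF assms(1,4,5)] .
  obtain e'' where e'': "other_diagonal (n + 1) (tree_diagonals Q) (diagonal_at Q v) e''"
    "tree_diagonals (rotate_at v Q) = exchange (diagonal_at Q v) e'' (tree_diagonals Q)"
    using rotate_at_flip[OF assms(2,8,9)] .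
  have Q: "diagonal_at Q v \<in> tree_diagonals Q"
    using diagonal_at_in_tree_diagonals assms(8,9) .
  have "diagonal_at Q v \<in> tree_diagonals (rotate_at w P)"
    using diagonal_at_in_tree_diagonals[OF assms(6,7)] assms(10) by simp
  \<comment> \<open>Every other diagonal of the rotated tree was already in \<open>P\<close>, hence
    is not in \<open>Q\<close>.\<close>
  then have "diagonal_at Q v = e'" using e'(2) Q assms(3) by (auto simp: exchange_def)
  then show ?thesis using that e' e'' Q by metis
qed

lemma layout_rotation_imp_pair_flip:
  assumes "layout_rotation P Q" "P \<in> irreducible_layouts n"
  shows "pair_flip (n + 1) (layout_diagonals P) (layout_diagonals Q)"
  using assms(1)
proof cases
  case (fst_single w P1 P2)
  have "num_leaves P1 = n" using assms(2) fst_single by (simp add: irreducible_layouts_def)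
  moreover have "tree_diagonals (rotate_at w P1) \<inter> tree_diagonals P2 = {}"
    using fst_single(5) by (simp add: irreducible_layout_iff)
  ultimately obtain e e' where "other_diagonal (n + 1) (tree_diagonals P1) e e'"
    "e' \<notin> tree_diagonals P2" "tree_diagonals (rotate_at w P1) = exchange e e' (tree_diagonals P1)"
    using single_rotation_flip fst_single(3,4) by metis
  then show ?thesis
    unfolding fst_single(1,2) layout_diagonals_def by (auto intro: pair_flip.fst_single)
next
  case (fst_double w P1 P2 u v)
  have "num_leaves P1 = n" "num_leaves P2 = n" "tree_diagonals P1 \<inter> tree_diagonals P2 = {}"
    using assms(2) fst_double(1) by (simp_all add: irreducible_layouts_def irreducible_layout_iff)
  then obtain e e' e'' where "other_diagonal (n + 1) (tree_diagonals P1) e e'"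
    "e' \<in> tree_diagonals P2" "other_diagonal (n + 1) (tree_diagonals P2) e' e''"
    "tree_diagonals (rotate_at w P1) = exchange e e' (tree_diagonals P1)"
    "tree_diagonals (rotate_at v P2) = exchange e' e'' (tree_diagonals P2)"
    using double_rotation_flip[of P1 n P2 w u v] fst_double(3-5)
    unfolding proper_subtanglegram_iff by metis
  then show ?thesis
    unfolding fst_double(1,2) layout_diagonals_def by (auto intro: pair_flip.fst_double)
next
  case (snd_single w P2 P1)
  have "num_leaves P2 = n" using assms(2) snd_single by (simp add: irreducible_layouts_def)
  moreover have "tree_diagonals (rotate_at w P2) \<inter> tree_diagonals P1 = {}"
    using snd_single(5) by (simp add: irreducible_layout_iff Int_commute)
  ultimately obtain e e' where "other_diagonal (n + 1) (tree_diagonals P2) e e'"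
    "e' \<notin> tree_diagonals P1" "tree_diagonals (rotate_at w P2) = exchange e e' (tree_diagonals P2)"
    using single_rotation_flip snd_single(3,4) by metis
  then show ?thesis
    unfolding snd_single(1,2) layout_diagonals_def by (auto intro: pair_flip.snd_single)
next
  case (snd_double w P2 P1 u v)
  have "num_leaves P2 = n" "num_leaves P1 = n" "tree_diagonals P2 \<inter> tree_diagonals P1 = {}"
    using assms(2) snd_double(1)
    by (simp_all add: irreducible_layouts_def irreducible_layout_iff Int_commute)
  then obtain e e' e'' where "other_diagonal (n + 1) (tree_diagonals P2) e e'"
    "e' \<in> tree_diagonals P1" "other_diagonal (n + 1) (tree_diagonals P1) e' e''"
    "tree_diagonals (rotate_at w P2) = exchange e e' (tree_diagonals P2)"
    "tree_diagonals (rotate_at u P1) = exchange e' e'' (tree_diagonals P1)"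
    \<comment> \<open>A proper subtanglegram names the vertex of the first tree first, so
      \<open>u\<close> and \<open>v\<close> change places.\<close>
    using double_rotation_flip[of P2 n P1 w v u] snd_double(3-5)
    unfolding proper_subtanglegram_iff by metis
  then show ?thesis
    unfolding snd_double(1,2) layout_diagonals_def by (auto intro: pair_flip.snd_double)
qed

lemma single_flip_rotation:
  assumes "num_leaves P = n" "other_diagonal (n + 1) (tree_diagonals P) e e'"
    and "e' \<notin> D" "tree_diagonals P \<inter> D = {}"
  obtains w where "w \<in> internal_vertices P" "w \<noteq> []" "tree_diagonals (rotate_at w P) \<inter> D = {}"
    "tree_diagonals (rotate_at w P) = exchange e e' (tree_diagonals P)"
  by (rule other_diagonal_rotate_at[OF assms(1,2)]) (use that assms(3,4) in \<open>auto simp: exchange_def\<close>)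

lemma double_flip_rotation:
  assumes "num_leaves P = n" "num_leaves Q = n"
    and "other_diagonal (n + 1) (tree_diagonals P) e e'"
    and "other_diagonal (n + 1) (tree_diagonals Q) e' e''"
  obtains w u v where "w \<in> internal_vertices P" "w \<noteq> []"
    "u \<in> internal_vertices (rotate_at w P)" "u \<noteq> []" "v \<in> internal_vertices Q" "v \<noteq> []"
    "diagonal_at (rotate_at w P) u = diagonal_at Q v"
    "tree_diagonals (rotate_at w P) = exchange e e' (tree_diagonals P)"
    "tree_diagonals (rotate_at v Q) = exchange e' e'' (tree_diagonals Q)"
proof -
  obtain w where w: "w \<in> internal_vertices P" "w \<noteq> []"
    "tree_diagonals (rotate_at w P) = exchange e e' (tree_diagonals P)"
    using other_diagonal_rotate_at[OF assms(1,3)] .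
  obtain v where v: "v \<in> internal_vertices Q" "v \<noteq> []" "diagonal_at Q v = e'"
    "tree_diagonals (rotate_at v Q) = exchange e' e'' (tree_diagonals Q)"
    using other_diagonal_rotate_at[OF assms(2,4)] .
  \<comment> \<open>The new diagonal sits at some vertex of the rotated tree; with \<open>v\<close>
    this vertex forms the proper subtanglegram that calls for the second rotation.\<close>
  have "e' \<in> tree_diagonals (rotate_at w P)" using w(3) by (simp add: exchange_def)
  then obtain u where "u \<in> internal_vertices (rotate_at w P)" "u \<noteq> []"
    "diagonal_at (rotate_at w P) u = e'"
    unfolding tree_diagonals_eq by auto
  then show ?thesis using that w v by metis
qed

lemma pair_flip_imp_layout_rotation:
  assumes "pair_flip (n + 1) (layout_diagonals P) (layout_diagonals Q)" "n \<ge> 2"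
    and "P \<in> irreducible_layouts n" "Q \<in> irreducible_layouts n"
  shows "layout_rotation P Q"
proof -
  obtain P1 P2 Q1 Q2 where PQ: "P = (P1, P2)" "Q = (Q1, Q2)" by fastforce
  have n: "num_leaves P1 = n" "num_leaves P2 = n" "num_leaves Q1 = n" "num_leaves Q2 = n"
    using assms(3,4) PQ by (simp_all add: irreducible_layouts_def)
  have disj: "tree_diagonals P1 \<inter> tree_diagonals P2 = {}" "tree_diagonals P2 \<inter> tree_diagonals P1 = {}"
    using assms(3) PQ by (auto simp: irreducible_layouts_def irreducible_layout_iff)
  \<comment> \<open>Flips fix only the sets of diagonals; injectivity is what makes \<open>Q\<close>
    literally the rotated layout.\<close>
  have inject: "t = u"
    if "num_leaves t = n" "num_leaves u = n" "tree_diagonals t = tree_diagonals u" for t u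
    using tree_diagonals_inject[OF that assms(2)] .
  from assms(1) have "pair_flip (n + 1) (tree_diagonals P1, tree_diagonals P2)
      (tree_diagonals Q1, tree_diagonals Q2)"
    by (simp add: PQ layout_diagonals_def)
  then have "layout_rotation (P1, P2) (Q1, Q2)"
  proof cases
    case (fst_single e e')
    obtain w where w: "w \<in> internal_vertices P1" "w \<noteq> []"
      "tree_diagonals (rotate_at w P1) \<inter> tree_diagonals P2 = {}"
      "tree_diagonals (rotate_at w P1) = exchange e e' (tree_diagonals P1)"
      using single_flip_rotation[OF n(1) fst_single(3,4) disj(1)] .
    then have "Q1 = rotate_at w P1" "Q2 = P2" using fst_single(1,2) n by (simp_all add: inject)
    then show ?thesis using w by (simp add: layout_rotation.fst_single irreducible_layout_iff)
  next
    case (fst_double e e' e'')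
    obtain w u v where w: "w \<in> internal_vertices P1" "w \<noteq> []"
      "u \<in> internal_vertices (rotate_at w P1)" "u \<noteq> []" "v \<in> internal_vertices P2" "v \<noteq> []"
      "diagonal_at (rotate_at w P1) u = diagonal_at P2 v"
      "tree_diagonals (rotate_at w P1) = exchange e e' (tree_diagonals P1)"
      "tree_diagonals (rotate_at v P2) = exchange e' e'' (tree_diagonals P2)"
      using double_flip_rotation[OF n(1,2) fst_double(3,5)] .
    have "proper_subtanglegram (rotate_at w P1, P2) u v"
      using w(3-7) by (simp add: proper_subtanglegram_iff)
    moreover have "Q1 = rotate_at w P1" "Q2 = rotate_at v P2"
      using w(8,9) fst_double(1,2) n by (simp_all add: inject)
    ultimately show ?thesis using w(1,2) layout_rotation.fst_double by metis
  next
    case (snd_single e e')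
    obtain w where w: "w \<in> internal_vertices P2" "w \<noteq> []"
      "tree_diagonals (rotate_at w P2) \<inter> tree_diagonals P1 = {}"
      "tree_diagonals (rotate_at w P2) = exchange e e' (tree_diagonals P2)"
      using single_flip_rotation[OF n(2) snd_single(3,4) disj(2)] .
    then have "Q1 = P1" "Q2 = rotate_at w P2" using snd_single(1,2) n by (simp_all add: inject)
    then show ?thesis
      using w by (simp add: layout_rotation.snd_single irreducible_layout_iff Int_commute)
  next
    case (snd_double e e' e'')
    obtain w u v where w: "w \<in> internal_vertices P2" "w \<noteq> []"
      "u \<in> internal_vertices (rotate_at w P2)" "u \<noteq> []" "v \<in> internal_vertices P1" "v \<noteq> []"
      "diagonal_at (rotate_at w P2) u = diagonal_at P1 v"
      "tree_diagonals (rotate_at w P2) = exchange e e' (tree_diagonals P2)"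
      "tree_diagonals (rotate_at v P1) = exchange e' e'' (tree_diagonals P1)"
      using double_flip_rotation[OF n(2,1) snd_double(3,5)] .
    have "proper_subtanglegram (P1, rotate_at w P2) v u"
      using w(3-7) by (simp add: proper_subtanglegram_iff)
    moreover have "Q2 = rotate_at w P2" "Q1 = rotate_at v P1"
      using w(8,9) snd_double(1,2) n by (simp_all add: inject)
    ultimately show ?thesis using w(1,2) layout_rotation.snd_double by metis
  qed
  then show ?thesis using PQ by simp
qed

section \<open>Graph isomorphism from a vertex bijection\<close>

text \<open>Arcs are pairs of vertices, so the arc map is induced by \<open>f\<close>, and its
  injectivity on arcs follows from that of \<open>f\<close> because arcs end in vertices.\<close>

lemma digraph_iso_with_projI:
  assumes bij: "bij_betw f (pverts G) (pverts H)"
    and wf: "parcs G \<subseteq> pverts G \<times> pverts G" "parcs H \<subseteq> pverts H \<times> pverts H"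
    and arcs: "\<And>u v. u \<in> pverts G \<Longrightarrow> v \<in> pverts G \<Longrightarrow> (u, v) \<in> parcs G \<longleftrightarrow> (f u, f v) \<in> parcs H"
  shows "digraph_iso (with_proj G) (with_proj H)"
proof -
  let ?h = "\<lparr> iso_verts = f, iso_arcs = map_prod f f, iso_head = snd, iso_tail = fst \<rparr>"
  have inj: "inj_on f (pverts G)" and img: "f ` pverts G = pverts H"
    using bij by (auto simp: bij_betw_def)
  have "wf_digraph (with_proj G)" using wf(1) by unfold_locales auto
  moreover have "inj_on (map_prod f f) (parcs G)"
    using map_prod_inj_on[OF inj inj] wf(1) by (rule inj_on_subset)
  ultimately have "pre_digraph.digraph_isomorphism (with_proj G) ?h"
    using inj by (simp add: pre_digraph.digraph_isomorphism_def)
  moreover have "map_prod f f ` parcs G = parcs H"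
  proof
    show "map_prod f f ` parcs G \<subseteq> parcs H" using wf(1) arcs by auto
    show "parcs H \<subseteq> map_prod f f ` parcs G"
    proof
      fix a assume a: "a \<in> parcs H"
      then obtain u v where "u \<in> pverts G" "v \<in> pverts G" "a = (f u, f v)"
        using wf(2) img by (cases a) blast
      then show "a \<in> map_prod f f ` parcs G" using a arcs by force
    qed
  qed
  then have "with_proj H = app_iso ?h (with_proj G)"
    by (simp add: app_iso_def with_proj_def img)
  ultimately show ?thesis unfolding digraph_iso_def by blast
qed

theorem theorem4p9:
  fixes n :: nat
  assumes "n \<ge> 2"
  shows "digraph_iso (with_proj (layout_graph n)) (with_proj (flip_graph (n + 1)))"
proof (rule digraph_iso_with_projI)
  show bij: "bij_betw layout_diagonals (pverts (layout_graph n)) (pverts (flip_graph (n + 1)))"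
    using bij_betw_layout_diagonals[OF assms] by (simp add: layout_graph_def flip_graph_def)
  show "parcs (layout_graph n) \<subseteq> pverts (layout_graph n) \<times> pverts (layout_graph n)"
    by (auto simp: layout_graph_def)
  show "parcs (flip_graph (n + 1)) \<subseteq> pverts (flip_graph (n + 1)) \<times> pverts (flip_graph (n + 1))"
    by (auto simp: flip_graph_def)
  fix P Q assume "P \<in> pverts (layout_graph n)" "Q \<in> pverts (layout_graph n)"
  then have PQ: "P \<in> irreducible_layouts n" "Q \<in> irreducible_layouts n"
    by (simp_all add: layout_graph_def)
  then have "layout_diagonals P \<in> disjoint_triangulations (n + 1)"
    "layout_diagonals Q \<in> disjoint_triangulations (n + 1)"
    using bij_betw_layout_diagonals[OF assms] by (auto simp: bij_betw_def)
  \<comment> \<open>Both adjacencies are symmetrised, so the correspondence of directed moves is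
    used for \<open>(P, Q)\<close> and for \<open>(Q, P)\<close>.\<close>
  then show "(P, Q) \<in> parcs (layout_graph n) \<longleftrightarrow>
      (layout_diagonals P, layout_diagonals Q) \<in> parcs (flip_graph (n + 1))"
    using PQ layout_rotation_imp_pair_flip[of P Q n] layout_rotation_imp_pair_flip[of Q P n]
      pair_flip_imp_layout_rotation[of n P Q] pair_flip_imp_layout_rotation[of n Q P] assms
    by (auto simp: layout_graph_def flip_graph_def)
qed

end
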